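(* Let $b,x\in\mathbb{C}^*$ and, for $n\ge2$, let $\omega_1:VL_n\longrightarrow\mathrm{GL}_n(\mathbb{C})$ be the representation of the virtual triplet group given for $1\le i\le n-1$ by \[ \omega_1(\ell_i)=\begin{pmatrix} I_{i-1}&0&0\\ 0&\begin{pmatrix}0&b\\ \frac1b&0\end{pmatrix}&0\\ 0&0&I_{n-i-1}\end{pmatrix},\qquad \omega_1(\rho_i)=\begin{pmatrix} I_{i-1}&0&0\\ 0&\begin{pmatrix}0&x\\ \frac1x&0\end{pmatrix}&0\\ 0&0&I_{n-i-1}\end{pmatrix}. \] Then the following hold. (1) For $n=2$, $\omega_1$ is unfaithful if and only if $\frac{b}{x}$ is an $m$-th root of unity for some positive integer $m$. (2) $\omega_1$ is unfaithful for all $n\ge3$.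
   Context: The virtual triplet group $VL_n$ is generated by $\ell_1,\ldots,\ell_{n-1},\rho_1,\ldots,\rho_{n-1}$ subject to: $\ell_i^2=1$ and $\rho_i^2=1$ ($1\le i\le n-1$); $\ell_i\ell_{i+1}\ell_i=\ell_{i+1}\ell_i\ell_{i+1}$ and $\rho_i\rho_{i+1}\rho_i=\rho_{i+1}\rho_i\rho_{i+1}$ ($1\le i\le n-2$); $\rho_i\rho_j=\rho_j\rho_i$ and $\ell_i\rho_j=\rho_j\ell_i$ ($|i-j|\ge2$); $\rho_i\rho_{i+1}\ell_i=\ell_{i+1}\rho_i\rho_{i+1}$ ($1\le i\le n-2$). (No commutation relations among the $\ell_i$ are imposed.) In particular $VL_2=\langle\ell_1,\rho_1\mid\ell_1^2=\rho_1^2=1\rangle$. $I_r$ denotes the $r\times r$ identity matrix. A representation is unfaithful if it is not injective. *)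

theory Defs
  imports "HOL-Algebra.Group" "Jordan_Normal_Form.Matrix"
begin

text \<open>Groups given by generators and relations. A letter \<open>(g, False)\<close> stands for the generator
  \<open>g\<close> and \<open>(g, True)\<close> for its formal inverse; a pair \<open>(r, s)\<close> of words in \<open>R\<close> stands for the
  relation \<open>r = s\<close>.\<close>

type_synonym 'g word = "('g \<times> bool) list"

definition words :: "'g set \<Rightarrow> 'g word set" where
  "words S = lists (S \<times> UNIV)"

inductive_set pres_cong :: "'g set \<Rightarrow> ('g word \<times> 'g word) set \<Rightarrow> ('g word \<times> 'g word) set"
  for S :: "'g set" and R :: "('g word \<times> 'g word) set" where
  refl: "w \<in> words S \<Longrightarrow> (w, w) \<in> pres_cong S R"
| sym: "(v, w) \<in> pres_cong S R \<Longrightarrow> (w, v) \<in> pres_cong S R"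
| trans: "(u, v) \<in> pres_cong S R \<Longrightarrow> (v, w) \<in> pres_cong S R \<Longrightarrow> (u, w) \<in> pres_cong S R"
| cancel: "u \<in> words S \<Longrightarrow> v \<in> words S \<Longrightarrow> g \<in> S
    \<Longrightarrow> (u @ [(g, e), (g, \<not> e)] @ v, u @ v) \<in> pres_cong S R"
| rel: "u \<in> words S \<Longrightarrow> v \<in> words S \<Longrightarrow> r \<in> words S \<Longrightarrow> s \<in> words S \<Longrightarrow> (r, s) \<in> R
    \<Longrightarrow> (u @ r @ v, u @ s @ v) \<in> pres_cong S R"

definition presented_group :: "'g set \<Rightarrow> ('g word \<times> 'g word) set \<Rightarrow> 'g word set monoid" where
  "presented_group S R = \<lparr>
     carrier = words S // pres_cong S R,
     monoid.mult = (\<lambda>A B. {w. \<exists>u\<in>A. \<exists>v\<in>B. (u @ v, w) \<in> pres_cong S R}),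
     one = pres_cong S R `` {[]} \<rparr>"

definition pres_class :: "'g set \<Rightarrow> ('g word \<times> 'g word) set \<Rightarrow> 'g word \<Rightarrow> 'g word set" where
  "pres_class S R w = pres_cong S R `` {w}"

lemma words_simps [simp]:
  "[] \<in> words S" "u @ v \<in> words S \<longleftrightarrow> u \<in> words S \<and> v \<in> words S"
  "(g, e) # w \<in> words S \<longleftrightarrow> g \<in> S \<and> w \<in> words S"
  by (auto simp: words_def)

lemma pres_cong_words: "(u, v) \<in> pres_cong S R \<Longrightarrow> u \<in> words S \<and> v \<in> words S"
  by (induction rule: pres_cong.induct) auto

lemma equiv_pres_cong: "equiv (words S) (pres_cong S R)"
  by (rule equivI)
    (auto simp: refl_on_def sym_def trans_def dest: pres_cong_words intro: pres_cong.intros)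

lemma pres_cong_context:
  assumes "(u, v) \<in> pres_cong S R" "a \<in> words S" "b \<in> words S"
  shows "(a @ u @ b, a @ v @ b) \<in> pres_cong S R"
  using assms
proof (induction rule: pres_cong.induct)
  case (cancel u v g e)
  then show ?case using pres_cong.cancel[of "a @ u" S "v @ b" g e R] by simp
next
  case (rel u v r s)
  then show ?case using pres_cong.rel[of "a @ u" S "v @ b" r s R] by simp
qed (auto intro: pres_cong.refl pres_cong.sym pres_cong.trans)

lemma pres_cong_append:
  assumes "(u, u') \<in> pres_cong S R" "(v, v') \<in> pres_cong S R"
  shows "(u @ v, u' @ v') \<in> pres_cong S R"
proof (rule pres_cong.trans)
  show "(u @ v, u' @ v) \<in> pres_cong S R"
    using pres_cong_context[OF assms(1), of "[]" v] assms(2) by (auto dest: pres_cong_words)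
  show "(u' @ v, u' @ v') \<in> pres_cong S R"
    using pres_cong_context[OF assms(2), of u' "[]"] assms(1) by (auto dest: pres_cong_words)
qed

lemma carrier_presented: "carrier (presented_group S R) = pres_class S R ` words S"
  by (auto simp: presented_group_def quotient_def pres_class_def)

lemma one_presented: "\<one>\<^bsub>presented_group S R\<^esub> = pres_class S R []"
  by (simp add: presented_group_def pres_class_def)

lemma pres_class_eq_iff:
  "u \<in> words S \<Longrightarrow> v \<in> words S \<Longrightarrow> pres_class S R u = pres_class S R v \<longleftrightarrow> (u, v) \<in> pres_cong S R"
  unfolding pres_class_def by (rule eq_equiv_class_iff[OF equiv_pres_cong])

lemma mult_presented:
  assumes "u \<in> words S" "v \<in> words S"
  shows "pres_class S R u \<otimes>\<^bsub>presented_group S R\<^esub> pres_class S R v = pres_class S R (u @ v)"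
proof -
  have "(u @ v, w) \<in> pres_cong S R"
    if "(u, u') \<in> pres_cong S R" "(v, v') \<in> pres_cong S R" "(u' @ v', w) \<in> pres_cong S R" for u' v' w
    using pres_cong_append[OF that(1,2)] that(3) by (rule pres_cong.trans)
  moreover have "(u, u) \<in> pres_cong S R" "(v, v) \<in> pres_cong S R"
    using assms by (auto intro: pres_cong.refl)
  ultimately show ?thesis
    unfolding presented_group_def pres_class_def by auto
qed

definition inv_word :: "'g word \<Rightarrow> 'g word" where
  "inv_word w = rev (map (\<lambda>(g, e). (g, \<not> e)) w)"

lemma inv_word_words: "w \<in> words S \<Longrightarrow> inv_word w \<in> words S"
  by (auto simp: inv_word_def words_def)

lemma inv_word_cancel: "w \<in> words S \<Longrightarrow> (inv_word w @ w, []) \<in> pres_cong S R"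
proof (induction w)
  case Nil
  then show ?case by (auto simp: inv_word_def intro: pres_cong.refl)
next
  case (Cons a w)
  obtain g e where a: "a = (g, e)" by force
  have "(inv_word w @ [(g, \<not> e), (g, \<not> \<not> e)] @ w, inv_word w @ w) \<in> pres_cong S R"
    using Cons.prems a by (intro pres_cong.cancel) (auto intro: inv_word_words)
  with Cons a show ?case by (auto simp: inv_word_def intro: pres_cong.trans)
qed

lemma group_presented: "group (presented_group S R)"
proof (rule groupI)
  fix x assume "x \<in> carrier (presented_group S R)"
  then obtain u where u: "u \<in> words S" "x = pres_class S R u" by (auto simp: carrier_presented)
  show "\<exists>y\<in>carrier (presented_group S R). y \<otimes>\<^bsub>presented_group S R\<^esub> x = \<one>\<^bsub>presented_group S R\<^esub>"
    using u inv_word_cancel[OF u(1), of R] inv_word_words[OF u(1)]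
    by (auto simp: carrier_presented mult_presented one_presented pres_class_eq_iff
        intro!: bexI[of _ "inv_word u"])
qed (auto simp: carrier_presented mult_presented one_presented)

fun eval_word :: "('h, 'k) monoid_scheme \<Rightarrow> ('g \<Rightarrow> 'h) \<Rightarrow> 'g word \<Rightarrow> 'h" where
  "eval_word G f [] = \<one>\<^bsub>G\<^esub>"
| "eval_word G f ((g, e) # w) = (if e then inv\<^bsub>G\<^esub> (f g) else f g) \<otimes>\<^bsub>G\<^esub> eval_word G f w"

lemma presented_lift:
  fixes G :: "('h, 'k) monoid_scheme"
  assumes G: "group G" and f: "\<And>g. g \<in> S \<Longrightarrow> f g \<in> carrier G"
    and R: "\<And>r s. (r, s) \<in> R \<Longrightarrow> eval_word G f r = eval_word G f s"
  shows "\<exists>h \<in> hom (presented_group S R) G. \<forall>g\<in>S. h (pres_class S R [(g, False)]) = f g"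
proof -
  interpret group G by (rule G)
  have closed: "eval_word G f w \<in> carrier G" if "w \<in> words S" for w
    using that by (induction w) (auto simp: f)
  have app: "eval_word G f (u @ v) = eval_word G f u \<otimes>\<^bsub>G\<^esub> eval_word G f v"
    if "u \<in> words S" "v \<in> words S" for u v
    using that by (induction u) (auto simp: f closed m_assoc)
  have cong: "eval_word G f u = eval_word G f v" if "(u, v) \<in> pres_cong S R" for u v
    using that
  proof (induction rule: pres_cong.induct)
    case (cancel u v g e)
    have "eval_word G f ([(g, e), (g, \<not> e)] @ v) = eval_word G f v"
      using cancel by (cases e) (simp_all add: f closed m_assoc[symmetric])
    with cancel show ?case by (simp add: app del: append_Cons)
  next
    case (rel u v r s)
    then show ?case by (simp add: app R)
  qed auto
  define h where "h A = eval_word G f (SOME w. w \<in> A)" for A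
  have h: "h (pres_class S R w) = eval_word G f w" if "w \<in> words S" for w
  proof -
    have "w \<in> pres_class S R w"
      using that by (auto simp: pres_class_def intro: pres_cong.refl)
    then have "(SOME v. v \<in> pres_class S R w) \<in> pres_class S R w" by (rule someI)
    then show ?thesis
      unfolding h_def using cong by (auto simp: pres_class_def)
  qed
  have "h \<in> hom (presented_group S R) G"
    by (auto simp: hom_def carrier_presented h closed mult_presented app)
  moreover have "\<forall>g\<in>S. h (pres_class S R [(g, False)]) = f g"
    by (simp add: h f)
  ultimately show ?thesis by blast
qed


datatype vl_gen = Ell nat | Rho nat

abbreviation lw :: "nat \<Rightarrow> vl_gen \<times> bool" where "lw i \<equiv> (Ell i, False)"
abbreviation rw :: "nat \<Rightarrow> vl_gen \<times> bool" where "rw i \<equiv> (Rho i, False)"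

definition VL_gens :: "nat \<Rightarrow> vl_gen set" where
  "VL_gens n = Ell ` {1..n - 1} \<union> Rho ` {1..n - 1}"

text \<open>Indices are 1-based, and no commutation relations among the \<open>Ell i\<close> are imposed.\<close>

inductive_set VL_rels :: "nat \<Rightarrow> (vl_gen word \<times> vl_gen word) set" for n :: nat where
  ell_sq: "i \<in> {1..n - 1} \<Longrightarrow> ([lw i, lw i], []) \<in> VL_rels n"
| rho_sq: "i \<in> {1..n - 1} \<Longrightarrow> ([rw i, rw i], []) \<in> VL_rels n"
| ell_braid: "i \<in> {1..n - 2} \<Longrightarrow>
    ([lw i, lw (i + 1), lw i], [lw (i + 1), lw i, lw (i + 1)]) \<in> VL_rels n"
| rho_braid: "i \<in> {1..n - 2} \<Longrightarrow>
    ([rw i, rw (i + 1), rw i], [rw (i + 1), rw i, rw (i + 1)]) \<in> VL_rels n"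
| rho_comm: "i \<in> {1..n - 1} \<Longrightarrow> j \<in> {1..n - 1} \<Longrightarrow> \<bar>int i - int j\<bar> \<ge> 2 \<Longrightarrow>
    ([rw i, rw j], [rw j, rw i]) \<in> VL_rels n"
| mixed_comm: "i \<in> {1..n - 1} \<Longrightarrow> j \<in> {1..n - 1} \<Longrightarrow> \<bar>int i - int j\<bar> \<ge> 2 \<Longrightarrow>
    ([lw i, rw j], [rw j, lw i]) \<in> VL_rels n"
| mixed_braid: "i \<in> {1..n - 2} \<Longrightarrow>
    ([rw i, rw (i + 1), lw i], [lw (i + 1), rw i, rw (i + 1)]) \<in> VL_rels n"

definition VL :: "nat \<Rightarrow> vl_gen word set monoid" where
  "VL n = presented_group (VL_gens n) (VL_rels n)"

definition vl_ell :: "nat \<Rightarrow> nat \<Rightarrow> vl_gen word set" where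
  "vl_ell n i = pres_class (VL_gens n) (VL_rels n) [lw i]"

definition vl_rho :: "nat \<Rightarrow> nat \<Rightarrow> vl_gen word set" where
  "vl_rho n i = pres_class (VL_gens n) (VL_rels n) [rw i]"

definition GL :: "nat \<Rightarrow> complex mat monoid" where
  "GL n = units_of (ring_mat TYPE(complex) n ())"

definition antidiag2 :: "complex \<Rightarrow> complex mat" where
  "antidiag2 t = mat_of_rows_list 2 [[0, t], [1 / t, 0]]"

definition block_gen :: "nat \<Rightarrow> complex \<Rightarrow> nat \<Rightarrow> complex mat" where
  "block_gen n t i = diag_block_mat [1\<^sub>m (i - 1), antidiag2 t, 1\<^sub>m (n - i - 1)]"

lemma group_VL: "group (VL n)"
  unfolding VL_def by (rule group_presented)

lemma group_GL: "group (GL n)"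
proof -
  interpret ring "ring_mat TYPE(complex) n ()" by (rule ring_mat)
  show ?thesis unfolding GL_def by (rule units_group)
qed

lemma GL_simps:
  "A \<otimes>\<^bsub>GL n\<^esub> B = A * B" "\<one>\<^bsub>GL n\<^esub> = 1\<^sub>m n"
  by (auto simp: GL_def units_of_def ring_mat_def)

text \<open>The matrices \<open>block_gen n t i\<close> are monomial; writing them as \<open>mono_mat\<close> reduces the
  relations of \<open>VL n\<close> to a finite case check. This yields \<open>omega1_exists\<close>, so that hypotheses
  prescribing a representation of \<open>VL n\<close> by its values on the generators are satisfiable.\<close>

definition mono_mat :: "nat \<Rightarrow> (nat \<Rightarrow> nat) \<Rightarrow> (nat \<Rightarrow> complex) \<Rightarrow> complex mat" where
  "mono_mat n p d = mat n n (\<lambda>(r, c). if c = p r then d r else 0)"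

lemma mono_mat_mult:
  assumes "\<And>r. r < n \<Longrightarrow> p r < n"
  shows "mono_mat n p d * mono_mat n q e = mono_mat n (q \<circ> p) (\<lambda>r. d r * e (p r))"
proof (rule eq_matI)
  fix r c assume "r < dim_row (mono_mat n (q \<circ> p) (\<lambda>r. d r * e (p r)))"
    "c < dim_col (mono_mat n (q \<circ> p) (\<lambda>r. d r * e (p r)))"
  then have rc: "r < n" "c < n" by (auto simp: mono_mat_def)
  have "(mono_mat n p d * mono_mat n q e) $$ (r, c) =
      (\<Sum>k = 0..<n. (if k = p r then d r else 0) * (if c = q k then e k else 0))"
    using rc by (auto simp: mono_mat_def scalar_prod_def intro!: sum.cong)
  also have "\<dots> = (\<Sum>k = 0..<n. if k = p r then d r * (if c = q (p r) then e (p r) else 0) else 0)"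
    by (intro sum.cong) auto
  also have "\<dots> = mono_mat n (q \<circ> p) (\<lambda>r. d r * e (p r)) $$ (r, c)"
    using rc assms[OF rc(1)] by (auto simp: mono_mat_def)
  finally show "(mono_mat n p d * mono_mat n q e) $$ (r, c) =
    mono_mat n (q \<circ> p) (\<lambda>r. d r * e (p r)) $$ (r, c)" .
qed (auto simp: mono_mat_def)

lemma mono_mat_one: "1\<^sub>m n = mono_mat n (\<lambda>r. r) (\<lambda>r. 1)"
  by (auto simp: mono_mat_def one_mat_def intro!: eq_matI)

lemma mono_mat_eqI:
  "(\<And>r. r < n \<Longrightarrow> p r = q r) \<Longrightarrow> (\<And>r. r < n \<Longrightarrow> d r = e r) \<Longrightarrow> mono_mat n p d = mono_mat n q e"
  by (auto simp: mono_mat_def intro!: eq_matI)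

definition tp :: "nat \<Rightarrow> nat \<Rightarrow> nat" where
  "tp i r = (if r = i - 1 then i else if r = i then i - 1 else r)"

definition tc :: "complex \<Rightarrow> nat \<Rightarrow> nat \<Rightarrow> complex" where
  "tc t i r = (if r = i - 1 then t else if r = i then 1 / t else 1)"

lemma block_gen_mono:
  assumes "1 \<le> i" "i < n"
  shows "block_gen n t i = mono_mat n (tp i) (tc t i)"
proof (rule eq_matI)
  fix r c assume "r < dim_row (mono_mat n (tp i) (tc t i))" "c < dim_col (mono_mat n (tp i) (tc t i))"
  then have rc: "r < n" "c < n" by (auto simp: mono_mat_def)
  obtain k where k: "i = Suc k"
    using assms(1) by (auto simp: Suc_le_eq gr0_conv_Suc)
  obtain l where n: "n = Suc (Suc (k + l))"
    using assms(2) k by (auto dest: less_imp_Suc_add)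
  have cases4: "m < k \<or> m = k \<or> m = Suc k \<or> (\<exists>q. m = Suc (Suc (k + q)))" for m
    by presburger
  from cases4[of r] cases4[of c]
  show "block_gen n t i $$ (r, c) = mono_mat n (tp i) (tc t i) $$ (r, c)"
    using rc unfolding k n
    by (elim disjE exE)
      (simp_all add: block_gen_def antidiag2_def mat_of_rows_list_def mono_mat_def tp_def tc_def)
qed (use assms in \<open>auto simp: block_gen_def antidiag2_def mat_of_rows_list_def mono_mat_def Let_def\<close>)

lemma tp_less: "i < n \<Longrightarrow> r < n \<Longrightarrow> tp i r < n"
  by (auto simp: tp_def)

lemma omega1_exists:
  fixes b x :: complex
  assumes "b \<noteq> 0" "x \<noteq> 0"
  shows "\<exists>\<omega> \<in> hom (VL n) (GL n). \<forall>i\<in>{1..n - 1}.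
    \<omega> (vl_ell n i) = block_gen n b i \<and> \<omega> (vl_rho n i) = block_gen n x i"
proof -
  define f where "f g = (case g of Ell i \<Rightarrow> block_gen n b i | Rho i \<Rightarrow> block_gen n x i)" for g
  have sq: "block_gen n t i * block_gen n t i = 1\<^sub>m n" if "t \<noteq> 0" "1 \<le> i" "i < n" for t i
  proof -
    from that(2) obtain k where k: "i = Suc k"
      by (auto simp: Suc_le_eq gr0_conv_Suc)
    have "tp i (tp i r) = r \<and> tc t i r * tc t i (tp i r) = 1" for r
      using that(1) by (simp add: tp_def tc_def k)
    then show ?thesis using that(2,3)
      by (simp add: block_gen_mono mono_mat_mult tp_less mono_mat_one comp_def)
  qed
  have unit: "block_gen n t i \<in> carrier (GL n)" if "t \<noteq> 0" "1 \<le> i" "i < n" for t i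
  proof -
    have "block_gen n t i \<in> carrier_mat n n"
      using that by (auto simp: block_gen_mono mono_mat_def)
    then show ?thesis
      using sq[OF that] by (auto simp: GL_def units_of_def Units_def ring_mat_def)
  qed
  have f_unit: "f g \<in> carrier (GL n)" if "g \<in> VL_gens n" for g
    using that assms by (auto simp: VL_gens_def f_def intro!: unit)
  have carr: "block_gen n t i \<in> carrier_mat n n" if "1 \<le> i" "i < n" for t i
    using that by (auto simp: block_gen_mono mono_mat_def)
  have braid: "block_gen n s i * (block_gen n s (Suc i) * block_gen n u i) =
      block_gen n u (Suc i) * (block_gen n s i * block_gen n s (Suc i))"
    if "s \<noteq> 0" "u \<noteq> 0" "1 \<le> i" "Suc i < n" for s u i
  proof -
    from that(3) obtain k where k: "i = Suc k"
      by (auto simp: Suc_le_eq gr0_conv_Suc)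
    have "tp i (tp (Suc i) (tp i r)) = tp (Suc i) (tp i (tp (Suc i) r)) \<and>
        tc s i r * (tc s (Suc i) (tp i r) * tc u i (tp (Suc i) (tp i r))) =
        tc u (Suc i) r * (tc s i (tp (Suc i) r) * tc s (Suc i) (tp i (tp (Suc i) r)))" for r
    proof -
      consider "r = k" | "r = Suc k" | "r = Suc (Suc k)"
        | "r \<noteq> k" "r \<noteq> Suc k" "r \<noteq> Suc (Suc k)" by blast
      then show ?thesis
        by cases (use that(1,2) in \<open>simp_all add: tp_def tc_def k\<close>)
    qed
    then show ?thesis using that(3,4)
      by (simp add: block_gen_mono mono_mat_mult tp_less comp_def)
  qed
  have comm: "block_gen n s i * block_gen n t j = block_gen n t j * block_gen n s i"
    if "1 \<le> i" "i < n" "1 \<le> j" "j < n" "\<bar>int i - int j\<bar> \<ge> 2" for s t i j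
  proof -
    from that(1,3) obtain k l where kl: "i = Suc k" "j = Suc l"
      by (auto simp: Suc_le_eq gr0_conv_Suc)
    have ne: "k \<noteq> l" "k \<noteq> Suc l" "Suc k \<noteq> l" "l \<noteq> k" "l \<noteq> Suc k" "Suc l \<noteq> k"
      using that(5) kl by auto
    have "tp j (tp i r) = tp i (tp j r) \<and> tc s i r * tc t j (tp i r) = tc t j r * tc s i (tp j r)"
      for r
    proof -
      consider "r = k" | "r = Suc k" | "r = l" | "r = Suc l"
        | "r \<noteq> k" "r \<noteq> Suc k" "r \<noteq> l" "r \<noteq> Suc l" by blast
      then show ?thesis
        by cases (simp_all add: tp_def tc_def kl ne)
    qed
    then show ?thesis using that(1-4)
      by (simp add: block_gen_mono mono_mat_mult tp_less comp_def)
  qed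
  have eval2: "eval_word (GL n) f [(g, False), (h, False)] = f g * f h"
    if "g \<in> VL_gens n" "h \<in> VL_gens n" for g h
  proof -
    have "f h \<in> carrier_mat n n" using that by (auto simp: VL_gens_def f_def carr)
    then show ?thesis by (simp add: GL_simps)
  qed
  have eval3: "eval_word (GL n) f [(g, False), (h, False), (k, False)] = f g * (f h * f k)"
    if "g \<in> VL_gens n" "h \<in> VL_gens n" "k \<in> VL_gens n" for g h k
  proof -
    have "f k \<in> carrier_mat n n" using that by (auto simp: VL_gens_def f_def carr)
    then show ?thesis by (simp add: GL_simps)
  qed
  have gens: "Ell i \<in> VL_gens n \<longleftrightarrow> 1 \<le> i \<and> i < n" "Rho i \<in> VL_gens n \<longleftrightarrow> 1 \<le> i \<and> i < n" for i
    by (auto simp: VL_gens_def)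
  have f_simps: "f (Ell i) = block_gen n b i" "f (Rho i) = block_gen n x i" for i
    by (simp_all add: f_def)
  have rels: "eval_word (GL n) f r = eval_word (GL n) f s" if rs: "(r, s) \<in> VL_rels n" for r s
    using rs
  proof cases
    case (ell_sq i)
    then have i: "1 \<le> i" "i < n" by auto
    have "eval_word (GL n) f s = 1\<^sub>m n" using ell_sq by (simp add: GL_simps)
    then show ?thesis
      unfolding ell_sq(1) by (simp only: eval2 gens i f_simps sq[OF assms(1) i] simp_thms)
  next
    case (rho_sq i)
    then have i: "1 \<le> i" "i < n" by auto
    have "eval_word (GL n) f s = 1\<^sub>m n" using rho_sq by (simp add: GL_simps)
    then show ?thesis
      unfolding rho_sq(1) by (simp only: eval2 gens i f_simps sq[OF assms(2) i] simp_thms)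
  next
    case (ell_braid i)
    then have i: "1 \<le> i" "i < n" "1 \<le> i + 1" "i + 1 < n" "Suc i < n" by auto
    show ?thesis
      unfolding ell_braid(1,2) using braid[OF assms(1) assms(1) i(1,5)]
      by (simp only: eval3 gens i f_simps simp_thms Suc_eq_plus1)
  next
    case (rho_braid i)
    then have i: "1 \<le> i" "i < n" "1 \<le> i + 1" "i + 1 < n" "Suc i < n" by auto
    show ?thesis
      unfolding rho_braid(1,2) using braid[OF assms(2) assms(2) i(1,5)]
      by (simp only: eval3 gens i f_simps simp_thms Suc_eq_plus1)
  next
    case (rho_comm i j)
    then have i: "1 \<le> i" "i < n" "1 \<le> j" "j < n" by auto
    show ?thesis
      unfolding rho_comm(1,2) using comm[OF i rho_comm(5)]
      by (simp only: eval2 gens i f_simps simp_thms)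
  next
    case (mixed_comm i j)
    then have i: "1 \<le> i" "i < n" "1 \<le> j" "j < n" by auto
    show ?thesis
      unfolding mixed_comm(1,2) using comm[OF i mixed_comm(5)]
      by (simp only: eval2 gens i f_simps simp_thms)
  next
    case (mixed_braid i)
    then have i: "1 \<le> i" "i < n" "1 \<le> i + 1" "i + 1 < n" "Suc i < n" by auto
    show ?thesis
      unfolding mixed_braid(1,2) using braid[OF assms(2) assms(1) i(1,5)]
      by (simp only: eval3 gens i f_simps simp_thms Suc_eq_plus1)
  qed
  obtain h where h: "h \<in> hom (VL n) (GL n)"
    "\<And>g. g \<in> VL_gens n \<Longrightarrow> h (pres_class (VL_gens n) (VL_rels n) [(g, False)]) = f g"
    using presented_lift[of "GL n" "VL_gens n" f "VL_rels n", OF group_GL f_unit rels]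
    unfolding VL_def by blast
  have "h (vl_ell n i) = block_gen n b i \<and> h (vl_rho n i) = block_gen n x i"
    if "i \<in> {1..n - 1}" for i
    using that h(2)[of "Ell i"] h(2)[of "Rho i"]
    by (simp add: vl_ell_def vl_rho_def f_simps VL_gens_def)
  with h(1) show ?thesis by blast
qed

end

theory Submission
  imports Defs "HOL-Algebra.Bij" "HOL-Algebra.Generated_Groups"
begin

text \<open>The image of \<open>\<ell>\<^sub>i \<rho>\<^sub>i\<close> is a diagonal matrix with entries \<open>b / x\<close>, \<open>x / b\<close> and
  ones, and both parts of the theorem rest on this.

  For \<open>n = 2\<close> the group is generated by two involutions, so every element is \<open>c\<^sup>k\<close> or \<open>c\<^sup>k \<rho>\<^sub>1\<close>
  with \<open>c = \<ell>\<^sub>1 \<rho>\<^sub>1\<close> (\<open>VL2_normal_form\<close>). The elements \<open>c\<^sup>k \<rho>\<^sub>1\<close> go to antidiagonal matrices, so a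
  nontrivial kernel element is some \<open>c\<^sup>k\<close> with \<open>(b / x)\<^sup>k = 1\<close> and \<open>k \<noteq> 0\<close>. Conversely, such a \<open>k\<close>
  makes the representation unfaithful because \<open>c\<close> has infinite order (\<open>VL2_pow_neq_one\<close>): the
  representation with parameters \<open>2\<close> and \<open>1\<close> sends it to a matrix of infinite order.

  For \<open>n \<ge> 3\<close> diagonal matrices commute, so the images of \<open>\<ell>\<^sub>1 \<rho>\<^sub>1\<close> and \<open>\<ell>\<^sub>2 \<rho>\<^sub>2\<close> commute, whereas
  these elements themselves do not (\<open>VL_pure_not_commute\<close>). The latter is witnessed by an action of
  \<open>VL\<^sub>n\<close> on sequences of labels from \<open>\<int>\<^sup>2\<close> (\<open>VL_strand_action\<close>): \<open>\<rho>\<^sub>i\<close> swaps the labels at \<open>i\<close> and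
  \<open>i + 1\<close>, and \<open>\<ell>\<^sub>i\<close> applies to them an involutive solution of the braid equation. The solution is
  chosen so that \<open>\<ell>\<^sub>1 \<rho>\<^sub>1\<close> and \<open>\<ell>\<^sub>2 \<rho>\<^sub>2\<close> act like generators of a Heisenberg group, with a
  nontrivial central commutator.\<close>

section \<open>Elements of a presented group\<close>

lemma pres_class_in_carrier:
  "w \<in> words S \<Longrightarrow> pres_class S R w \<in> carrier (presented_group S R)"
  by (simp add: carrier_presented)

lemma carrier_presented_generate:
  "carrier (presented_group S R) =
    generate (presented_group S R) ((\<lambda>g. pres_class S R [(g, False)]) ` S)"
  (is "carrier ?G = generate ?G ?X")
proof
  interpret group ?G by (rule group_presented)
  have "pres_class S R w \<in> generate ?G ?X" if "w \<in> words S" for w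
    using that
  proof (induction w)
    case Nil
    then show ?case
      using generate.one[of ?G ?X] by (simp add: one_presented)
  next
    case (Cons a w)
    obtain g e where a: "a = (g, e)" by force
    with Cons.prems have g: "g \<in> S" and w: "w \<in> words S" by auto
    have letter: "pres_class S R [(g, e)] \<in> generate ?G ?X"
    proof (cases e)
      case False
      with g show ?thesis by (auto intro: generate.incl)
    next
      case True
      have "([(g, True), (g, False)], []) \<in> pres_cong S R"
        using pres_cong.cancel[of "[]" S "[]" g True R] g by simp
      then have "pres_class S R [(g, True)] \<otimes>\<^bsub>?G\<^esub> pres_class S R [(g, False)] = \<one>\<^bsub>?G\<^esub>"
        using g by (simp add: mult_presented one_presented pres_class_eq_iff)
      then have "pres_class S R [(g, True)] = inv\<^bsub>?G\<^esub> (pres_class S R [(g, False)])"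
        using g by (intro inv_equality[symmetric]) (simp_all add: pres_class_in_carrier)
      with g True show ?thesis by (auto intro: generate.inv)
    qed
    have "pres_class S R (a # w) = pres_class S R [(g, e)] \<otimes>\<^bsub>?G\<^esub> pres_class S R w"
      using g w a by (simp add: mult_presented)
    with letter Cons.IH[OF w] show ?case by (simp add: generate.eng)
  qed
  then show "carrier ?G \<subseteq> generate ?G ?X"
    by (auto simp: carrier_presented)
  show "generate ?G ?X \<subseteq> carrier ?G"
    by (rule generate_incl) (auto simp: pres_class_in_carrier)
qed

lemma vl_ell_carrier: "i \<in> {1..n - 1} \<Longrightarrow> vl_ell n i \<in> carrier (VL n)"
  and vl_rho_carrier: "i \<in> {1..n - 1} \<Longrightarrow> vl_rho n i \<in> carrier (VL n)"
  by (auto simp: vl_ell_def vl_rho_def VL_def VL_gens_def intro!: pres_class_in_carrier)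

lemma pres_class_relation:
  assumes "(r, s) \<in> R" "r \<in> words S" "s \<in> words S"
  shows "pres_class S R r = pres_class S R s"
  using assms pres_cong.rel[of "[]" S "[]" r s R] by (simp add: pres_class_eq_iff)

lemma vl_ell_square: "i \<in> {1..n - 1} \<Longrightarrow> vl_ell n i \<otimes>\<^bsub>VL n\<^esub> vl_ell n i = \<one>\<^bsub>VL n\<^esub>"
  and vl_rho_square: "i \<in> {1..n - 1} \<Longrightarrow> vl_rho n i \<otimes>\<^bsub>VL n\<^esub> vl_rho n i = \<one>\<^bsub>VL n\<^esub>"
  by (simp_all add: VL_def vl_ell_def vl_rho_def one_presented mult_presented VL_gens_def
      pres_class_relation VL_rels.intros)

section \<open>Groups generated by two involutions\<close>

text \<open>Conjugation by \<open>b\<close> inverts \<open>c = a \<otimes> b\<close>. Hence the elements \<open>c\<^sup>k\<close> and \<open>c\<^sup>k \<otimes> b\<close> form a set that is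
  stable under left multiplication by \<open>b\<close> and by \<open>c\<close>, and so by \<open>a = c \<otimes> b\<close>.\<close>

lemma (in group) two_involutions_normal_form:
  assumes a: "a \<in> carrier G" "a \<otimes> a = \<one>" and b: "b \<in> carrier G" "b \<otimes> b = \<one>"
    and y: "y \<in> generate G {a, b}"
  shows "\<exists>k::int. y = (a \<otimes> b) [^] k \<or> y = (a \<otimes> b) [^] k \<otimes> b"
proof -
  define c where "c = a \<otimes> b"
  have c: "c \<in> carrier G" using a b by (simp add: c_def)
  have cb: "c \<otimes> b = a" using a b by (simp add: c_def m_assoc)
  have inv_ab: "inv a = a" "inv b = b" using a b by (auto intro: inv_equality)
  have inv_c: "inv c = b \<otimes> a" using a b by (simp add: c_def inv_mult_group inv_ab)
  have conj: "b \<otimes> c [^] k \<otimes> b = c [^] (- k)" for k :: int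
  proof -
    have *: "b \<otimes> c [^] m \<otimes> b = inv c [^] m" for m :: nat
    proof (induction m)
      case 0
      then show ?case using b by simp
    next
      case (Suc m)
      have "b \<otimes> c [^] Suc m \<otimes> b = (b \<otimes> c [^] m \<otimes> b) \<otimes> (b \<otimes> c \<otimes> b)"
        using b c by (simp add: m_assoc flip: m_assoc[of b b])
      also have "b \<otimes> c \<otimes> b = inv c" using a b c by (simp add: m_assoc cb inv_c)
      finally show ?case using Suc by simp
    qed
    have inv_conj: "inv (b \<otimes> z \<otimes> b) = b \<otimes> inv z \<otimes> b" if "z \<in> carrier G" for z
      using b that by (simp add: inv_mult_group inv_ab m_assoc)
    show ?thesis
    proof (cases k rule: int_cases2)
      case (nonneg m)
      with * c show ?thesis by (simp add: int_pow_neg_int int_pow_int nat_pow_inv)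
    next
      case (nonpos m)
      then have "b \<otimes> c [^] k \<otimes> b = inv (b \<otimes> c [^] m \<otimes> b)"
        using c by (simp add: int_pow_neg_int inv_conj)
      also have "\<dots> = c [^] m" using * c by (simp add: nat_pow_inv)
      finally show ?thesis using nonpos by (simp add: int_pow_int)
    qed
  qed
  then have bc: "b \<otimes> c [^] k = c [^] (- k) \<otimes> b" for k :: int
    using b c by (metis int_pow_closed m_assoc m_closed r_one)
  define D where "D = {z. \<exists>k::int. z = c [^] k \<or> z = c [^] k \<otimes> b}"
  have b_D: "b \<otimes> z \<in> D" if z: "z \<in> D" for z
    using z unfolding D_def mem_Collect_eq
    by (metis bc conj b(1) c int_pow_closed m_assoc)
  have c_D: "c \<otimes> z \<in> D" if z: "z \<in> D" for z
  proof -
    have "c \<otimes> c [^] k = c [^] (1 + k)" for k :: int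
      using c int_pow_mult[of c 1 k] by simp
    with z b c show ?thesis
      unfolding D_def mem_Collect_eq by (metis int_pow_closed m_assoc)
  qed
  have "y \<otimes> z \<in> D" if "z \<in> D" for z
    using y that
  proof (induction arbitrary: z rule: generate.induct)
    case one
    then show ?case using b c by (auto simp: D_def)
  next
    case (incl h)
    have "a \<otimes> z = c \<otimes> (b \<otimes> z)" using incl.prems b c cb
      by (auto simp: D_def simp flip: m_assoc)
    with incl show ?case using b_D c_D by (metis insertE singletonD)
  next
    case (inv h)
    have "a \<otimes> z = c \<otimes> (b \<otimes> z)" using inv.prems b c cb
      by (auto simp: D_def simp flip: m_assoc)
    with inv show ?case using b_D c_D inv_ab by (metis insertE singletonD)
  next
    case (eng h1 h2)
    have "h1 \<in> carrier G" "h2 \<in> carrier G" "z \<in> carrier G"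
      using eng generate_in_carrier[of "{a, b}"] a b c by (auto simp: D_def)
    with eng show ?case by (simp add: m_assoc)
  qed
  moreover have "\<one> \<in> D" by (auto simp: D_def intro: exI[of _ "0::int"])
  ultimately have "y \<otimes> \<one> \<in> D" .
  moreover have "y \<in> carrier G"
    using y generate_in_carrier[of "{a, b}"] a b by auto
  ultimately show ?thesis by (simp add: D_def c_def)
qed

section \<open>Diagonal matrices in the image\<close>

text \<open>Both factors are monomial with the same underlying transposition, which cancels in the
  product.\<close>

lemma block_gen_mult_diagonal:
  assumes "1 \<le> i" "i < n"
  shows "block_gen n b i * block_gen n x i = mono_mat n (\<lambda>r. r) (\<lambda>r. tc b i r * tc x i (tp i r))"
proof -
  have "tp i (tp i r) = r" for r using assms by (auto simp: tp_def)
  then show ?thesis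
    using assms by (simp add: block_gen_mono mono_mat_mult tp_less comp_def)
qed

lemma diagonal_mult_commute:
  "mono_mat n (\<lambda>r. r) d * mono_mat n (\<lambda>r. r) e = mono_mat n (\<lambda>r. r) e * mono_mat n (\<lambda>r. r) d"
  by (simp add: mono_mat_mult comp_def mult.commute)

lemma GL_pow_diagonal:
  "mono_mat n (\<lambda>r. r) d [^]\<^bsub>GL n\<^esub> m = mono_mat n (\<lambda>r. r) (\<lambda>r. d r ^ m)" for m :: nat
proof (induction m)
  case 0
  interpret group "GL n" by (rule group_GL)
  show ?case by (simp add: GL_simps mono_mat_one)
next
  case (Suc m)
  interpret group "GL n" by (rule group_GL)
  show ?case by (simp add: Suc GL_simps mono_mat_mult comp_def mult.commute)
qed

lemma hom_GL_pow_VL2: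
  fixes m :: nat
  assumes \<omega>: "\<omega> \<in> hom (VL 2) (GL 2)"
    and ell: "\<omega> (vl_ell 2 1) = block_gen 2 b 1" and rho: "\<omega> (vl_rho 2 1) = block_gen 2 x 1"
  shows "\<omega> ((vl_ell 2 1 \<otimes>\<^bsub>VL 2\<^esub> vl_rho 2 1) [^]\<^bsub>VL 2\<^esub> m) =
    mono_mat 2 (\<lambda>r. r) (\<lambda>r. if r = 0 then (b / x) ^ m else (x / b) ^ m)"
proof -
  interpret group_hom "VL 2" "GL 2" \<omega>
    using \<omega> group_VL group_GL by (simp add: group_hom_def group_hom_axioms_def)
  have car: "vl_ell 2 1 \<in> carrier (VL 2)" "vl_rho 2 1 \<in> carrier (VL 2)"
    by (simp_all add: vl_ell_carrier vl_rho_carrier)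
  have "\<omega> (vl_ell 2 1 \<otimes>\<^bsub>VL 2\<^esub> vl_rho 2 1) =
      mono_mat 2 (\<lambda>r. r) (\<lambda>r. tc b 1 r * tc x 1 (tp 1 r))"
    using car by (simp add: ell rho GL_simps block_gen_mult_diagonal del: One_nat_def)
  then show ?thesis
    using car by (auto simp: hom_nat_pow GL_pow_diagonal tc_def tp_def intro!: mono_mat_eqI)
qed

text \<open>A homomorphism out of \<open>VL\<^sub>2\<close> separates the power from the identity: for the parameters \<open>2\<close> and \<open>1\<close>
  the upper left entry of the image is \<open>2\<^sup>m\<close>.\<close>

lemma VL2_pow_neq_one:
  fixes m :: nat
  assumes "m > 0"
  shows "(vl_ell 2 1 \<otimes>\<^bsub>VL 2\<^esub> vl_rho 2 1) [^]\<^bsub>VL 2\<^esub> m \<noteq> \<one>\<^bsub>VL 2\<^esub>" (is "?y \<noteq> _")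
proof
  assume one: "?y = \<one>\<^bsub>VL 2\<^esub>"
  obtain \<omega> where \<omega>: "\<omega> \<in> hom (VL 2) (GL 2)"
    "\<omega> (vl_ell 2 1) = block_gen 2 2 1" "\<omega> (vl_rho 2 1) = block_gen 2 1 1"
    using omega1_exists[of 2 1 2] by auto
  have "\<omega> ?y = 1\<^sub>m 2"
    using hom_one[OF \<omega>(1) group_VL group_GL] one by (simp add: GL_simps)
  then have "\<omega> ?y $$ (0, 0) = 1" by simp
  moreover have "\<omega> ?y $$ (0, 0) = 2 ^ m"
    by (simp add: hom_GL_pow_VL2[OF \<omega>] mono_mat_def del: One_nat_def)
  ultimately have "norm ((2::complex) ^ m) = 1" by simp
  then have "(2::real) ^ m = 1" by (simp add: norm_power)
  with assms one_less_power[of "2::real" m] show False by simp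
qed

section \<open>The group \<open>VL\<^sub>2\<close>\<close>

lemma VL2_normal_form:
  assumes "y \<in> carrier (VL 2)"
  shows "\<exists>k::int. y = (vl_ell 2 1 \<otimes>\<^bsub>VL 2\<^esub> vl_rho 2 1) [^]\<^bsub>VL 2\<^esub> k \<or>
    y = (vl_ell 2 1 \<otimes>\<^bsub>VL 2\<^esub> vl_rho 2 1) [^]\<^bsub>VL 2\<^esub> k \<otimes>\<^bsub>VL 2\<^esub> vl_rho 2 1"
proof -
  have "(\<lambda>g. pres_class (VL_gens 2) (VL_rels 2) [(g, False)]) ` VL_gens 2 =
      {vl_ell 2 1, vl_rho 2 1}"
    by (auto simp: VL_gens_def vl_ell_def vl_rho_def)
  then have "y \<in> generate (VL 2) {vl_ell 2 1, vl_rho 2 1}"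
    using assms carrier_presented_generate[of "VL_gens 2" "VL_rels 2"] by (simp add: VL_def)
  then show ?thesis
    by (intro group.two_involutions_normal_form[OF group_VL])
      (simp_all add: vl_ell_carrier vl_rho_carrier vl_ell_square vl_rho_square)
qed

text \<open>The exponent in the normal form is an integer, the one in the claim a positive natural number;
  a negative exponent is dealt with by inverting the kernel element.\<close>

lemma VL2_unfaithful_iff:
  assumes bx: "b \<noteq> 0" "x \<noteq> 0" and \<omega>: "\<omega> \<in> hom (VL 2) (GL 2)"
    and ell: "\<omega> (vl_ell 2 1) = block_gen 2 b 1" and rho: "\<omega> (vl_rho 2 1) = block_gen 2 x 1"
  shows "\<not> inj_on \<omega> (carrier (VL 2)) \<longleftrightarrow> (\<exists>m::nat. m > 0 \<and> (b / x) ^ m = 1)"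
proof -
  interpret group_hom "VL 2" "GL 2" \<omega>
    using \<omega> group_VL group_GL by (simp add: group_hom_def group_hom_axioms_def)
  define c where "c = vl_ell 2 1 \<otimes>\<^bsub>VL 2\<^esub> vl_rho 2 1"
  define r where "r = vl_rho 2 1"
  have r: "r \<in> carrier (VL 2)" "r \<otimes>\<^bsub>VL 2\<^esub> r = \<one>\<^bsub>VL 2\<^esub>"
    by (simp_all add: r_def vl_rho_carrier vl_rho_square)
  have c: "c \<in> carrier (VL 2)"
    by (simp add: c_def vl_ell_carrier vl_rho_carrier)
  have pow: "\<omega> (c [^]\<^bsub>VL 2\<^esub> m) =
      mono_mat 2 (\<lambda>r. r) (\<lambda>r. if r = 0 then (b / x) ^ m else (x / b) ^ m)" for m :: nat
    unfolding c_def by (rule hom_GL_pow_VL2[OF \<omega> ell rho])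
  have pow_one: "\<omega> (c [^]\<^bsub>VL 2\<^esub> m) = \<one>\<^bsub>GL 2\<^esub> \<longleftrightarrow> (b / x) ^ m = 1" for m :: nat
  proof
    assume "\<omega> (c [^]\<^bsub>VL 2\<^esub> m) = \<one>\<^bsub>GL 2\<^esub>"
    then have "\<omega> (c [^]\<^bsub>VL 2\<^esub> m) $$ (0, 0) = 1" by (simp add: GL_simps)
    then show "(b / x) ^ m = 1" by (simp add: pow mono_mat_def)
  next
    assume "(b / x) ^ m = 1"
    then have "(b / x) ^ m = 1" "(x / b) ^ m = 1"
      using bx by (simp_all add: power_divide)
    then show "\<omega> (c [^]\<^bsub>VL 2\<^esub> m) = \<one>\<^bsub>GL 2\<^esub>"
      unfolding GL_simps mono_mat_one pow by (intro mono_mat_eqI) auto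
  qed
  \<comment> \<open>The elements \<open>c\<^sup>k r\<close> never lie in the kernel: the left side is diagonal and the right
    side antidiagonal.\<close>
  have pow_r: "\<omega> (c [^]\<^bsub>VL 2\<^esub> m) \<noteq> \<omega> r" for m :: nat
  proof
    assume "\<omega> (c [^]\<^bsub>VL 2\<^esub> m) = \<omega> r"
    then have "\<omega> (c [^]\<^bsub>VL 2\<^esub> m) $$ (0, 0) = block_gen 2 x 1 $$ (0, 0)"
      by (simp add: r_def rho del: One_nat_def)
    then show False
      using bx by (simp add: pow block_gen_mono mono_mat_def tp_def)
  qed
  show ?thesis
  proof
    assume "\<not> inj_on \<omega> (carrier (VL 2))"
    then obtain y where y: "y \<in> carrier (VL 2)" "\<omega> y = \<one>\<^bsub>GL 2\<^esub>" "y \<noteq> \<one>\<^bsub>VL 2\<^esub>"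
      using inj_on_one_iff by auto
    from VL2_normal_form[OF y(1)] obtain k :: int
      where "y = c [^]\<^bsub>VL 2\<^esub> k \<or> y = c [^]\<^bsub>VL 2\<^esub> k \<otimes>\<^bsub>VL 2\<^esub> r"
      unfolding c_def r_def by blast
    then show "\<exists>m::nat. m > 0 \<and> (b / x) ^ m = 1"
    proof
      assume k: "y = c [^]\<^bsub>VL 2\<^esub> k"
      show ?thesis
      proof (cases k rule: int_cases2)
        case (nonneg m)
        then have "(b / x) ^ m = 1" "m \<noteq> 0"
          using k y c pow_one[of m] by (auto simp: int_pow_int)
        then show ?thesis by auto
      next
        case (nonpos m)
        then have "c [^]\<^bsub>VL 2\<^esub> m = inv\<^bsub>VL 2\<^esub> y"
          using k c by (simp add: G.int_pow_neg_int)
        then have "(b / x) ^ m = 1" using pow_one[of m] y by simp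
        moreover have "m \<noteq> 0" using nonpos k y(3) by auto
        ultimately show ?thesis by auto
      qed
    next
      assume k: "y = c [^]\<^bsub>VL 2\<^esub> k \<otimes>\<^bsub>VL 2\<^esub> r"
      have \<omega>r: "\<omega> r \<otimes>\<^bsub>GL 2\<^esub> \<omega> r = \<one>\<^bsub>GL 2\<^esub>"
        using r by (metis hom_mult hom_one)
      then have inv_r: "inv\<^bsub>GL 2\<^esub> (\<omega> r) = \<omega> r"
        using r by (simp add: H.inv_equality)
      have "\<omega> (c [^]\<^bsub>VL 2\<^esub> k) \<otimes>\<^bsub>GL 2\<^esub> \<omega> r = \<one>\<^bsub>GL 2\<^esub>"
        using k y(2) c r by simp
      then have ck: "\<omega> (c [^]\<^bsub>VL 2\<^esub> k) = \<omega> r"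
        using inv_r r c by (metis H.inv_equality H.inv_inv G.int_pow_closed hom_closed)
      have "False"
      proof (cases k rule: int_cases2)
        case (nonneg m)
        then show False using ck pow_r[of m] by (simp add: int_pow_int)
      next
        case (nonpos m)
        then have "inv\<^bsub>GL 2\<^esub> \<omega> (c [^]\<^bsub>VL 2\<^esub> m) = \<omega> r"
          using ck c by (simp add: G.int_pow_neg_int)
        then have "\<omega> (c [^]\<^bsub>VL 2\<^esub> m) = \<omega> r"
          using inv_r c by (metis H.inv_inv G.nat_pow_closed hom_closed)
        then show False using pow_r by blast
      qed
      then show ?thesis ..
    qed
  next
    assume "\<exists>m::nat. m > 0 \<and> (b / x) ^ m = 1"
    then obtain m :: nat where m: "m > 0" "\<omega> (c [^]\<^bsub>VL 2\<^esub> m) = \<one>\<^bsub>GL 2\<^esub>"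
      using pow_one by blast
    have "c [^]\<^bsub>VL 2\<^esub> m \<noteq> \<one>\<^bsub>VL 2\<^esub>"
      unfolding c_def by (rule VL2_pow_neq_one[OF m(1)])
    with m c show "\<not> inj_on \<omega> (carrier (VL 2))"
      using inj_on_one_iff by auto
  qed
qed

section \<open>An action of \<open>VL\<^sub>n\<close> on labelled strands\<close>

text \<open>A map of pairs, acting on the adjacent strands \<open>i\<close> and \<open>i + 1\<close> of a sequence of labels. It is
  indexed by all naturals, so that one action serves every \<open>n\<close>.\<close>

definition act_at :: "('a \<times> 'a \<Rightarrow> 'a \<times> 'a) \<Rightarrow> nat \<Rightarrow> (nat \<Rightarrow> 'a) \<Rightarrow> nat \<Rightarrow> 'a" where
  "act_at R i s = (case R (s i, s (Suc i)) of (u, v) \<Rightarrow> s(i := u, Suc i := v))"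

lemma act_at_involution: "R \<circ> R = id \<Longrightarrow> act_at R i \<circ> act_at R i = id"
  by (auto simp: act_at_def fun_eq_iff split: prod.splits) (metis prod.inject)+

lemma act_at_commute: "\<bar>int i - int j\<bar> \<ge> 2 \<Longrightarrow> act_at R i \<circ> act_at Q j = act_at Q j \<circ> act_at R i"
  by (auto simp: act_at_def fun_eq_iff split: prod.splits)

text \<open>Transporting \<open>R\<close> along swaps just moves it from one pair of strands to another. This settles the
  mixed relation of \<open>VL\<^sub>n\<close> for every \<open>R\<close>, and for \<open>R = prod.swap\<close> it is the braid relation.\<close>

lemma act_at_mixed_braid:
  "act_at prod.swap i \<circ> (act_at prod.swap (Suc i) \<circ> act_at R i) =
    act_at R (Suc i) \<circ> (act_at prod.swap i \<circ> act_at prod.swap (Suc i))"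
  by (auto simp: act_at_def fun_eq_iff split: prod.splits)

text \<open>Composed with the swap, this is the crossing
  \<open>((p, q), (p', q')) \<mapsto> ((p + 1, q + p'), (p' - 1, q' - p - 1))\<close>. Each crossing shifts the
  \<open>p\<close>-labels, and the \<open>q\<close>-labels record the \<open>p\<close>-label met at the crossing. Two crossings that share
  one strand can thus be told apart by their order, but only through a shift of \<open>q\<close>-labels, which
  commutes with every crossing; this is the Heisenberg commutation rule. The final \<open>- 1\<close> is forced
  by the map being an involution: exchanging the two strands must turn the crossing into its
  inverse, so the second strand subtracts the label \<open>p + 1\<close> that the first one has after its shift.\<close>

definition heis_braiding :: "(int \<times> int) \<times> (int \<times> int) \<Rightarrow> (int \<times> int) \<times> (int \<times> int)" where
  "heis_braiding = (\<lambda>((p, q), (p', q')). ((p' + 1, q' + p), (p - 1, q - p' - 1)))"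

lemma heis_braiding_involution: "heis_braiding \<circ> heis_braiding = id"
  by (auto simp: heis_braiding_def fun_eq_iff)

lemma heis_braiding_braid:
  "act_at heis_braiding i \<circ> (act_at heis_braiding (Suc i) \<circ> act_at heis_braiding i) =
    act_at heis_braiding (Suc i) \<circ> (act_at heis_braiding i \<circ> act_at heis_braiding (Suc i))"
  by (auto simp: act_at_def heis_braiding_def fun_eq_iff split: prod.splits)

lemma BijGroup_UNIV_mult:
  "bij f \<Longrightarrow> bij g \<Longrightarrow> f \<otimes>\<^bsub>BijGroup UNIV\<^esub> g = f \<circ> g"
  by (auto simp: BijGroup_def Bij_def compose_def)

lemma BijGroup_UNIV_one: "\<one>\<^bsub>BijGroup UNIV\<^esub> = id"
  by (auto simp: BijGroup_def)

lemma BijGroup_UNIV_carrier: "f \<in> carrier (BijGroup UNIV) \<longleftrightarrow> bij f"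
  by (auto simp: BijGroup_def Bij_def)

lemma VL_strand_action:
  "\<exists>h \<in> hom (VL n) (BijGroup UNIV). \<forall>i\<in>{1..n - 1}.
    h (vl_ell n i) = act_at heis_braiding i \<and> h (vl_rho n i) = act_at prod.swap i"
proof -
  define f where
    "f g = (case g of Ell i \<Rightarrow> act_at heis_braiding i | Rho i \<Rightarrow> act_at prod.swap i)" for g
  have f_simps: "f (Ell i) = act_at heis_braiding i" "f (Rho i) = act_at prod.swap i" for i
    by (simp_all add: f_def)
  have swap_inv: "prod.swap \<circ> prod.swap = (id :: (int \<times> int) \<times> _ \<Rightarrow> _)"
    by auto
  note sq = act_at_involution[OF heis_braiding_involution] act_at_involution[OF swap_inv]
  have bij: "bij (f g)" for g
    by (cases g) (auto simp: f_simps intro: o_bij[OF sq(1) sq(1)] o_bij[OF sq(2) sq(2)])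
  have eval2: "eval_word (BijGroup UNIV) f [(g, False), (h, False)] = f g \<circ> f h" for g h
    by (simp add: BijGroup_UNIV_mult BijGroup_UNIV_one bij bij_comp)
  have eval3: "eval_word (BijGroup UNIV) f [(g, False), (h, False), (k, False)] =
      f g \<circ> (f h \<circ> f k)" for g h k
    by (simp add: BijGroup_UNIV_mult BijGroup_UNIV_one bij bij_comp)
  have rels: "eval_word (BijGroup UNIV) f r = eval_word (BijGroup UNIV) f s"
    if "(r, s) \<in> VL_rels n" for r s
    using that
  proof cases
    case (rho_braid i)
    show ?thesis unfolding rho_braid eval3 f_simps
      using act_at_mixed_braid[of i prod.swap] by simp
  qed (simp_all only: eval2 eval3 f_simps sq act_at_commute heis_braiding_braid
      act_at_mixed_braid eval_word.simps(1) BijGroup_UNIV_one Suc_eq_plus1[symmetric])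
  obtain h where "h \<in> hom (VL n) (BijGroup UNIV)"
    "\<And>g. g \<in> VL_gens n \<Longrightarrow> h (pres_class (VL_gens n) (VL_rels n) [(g, False)]) = f g"
    using presented_lift[of "BijGroup UNIV" "VL_gens n" f "VL_rels n", OF group_BijGroup _ rels]
    unfolding VL_def BijGroup_UNIV_carrier using bij by blast
  then show ?thesis
    by (intro bexI[of _ h]) (auto simp: vl_ell_def vl_rho_def f_simps VL_gens_def)
qed

text \<open>Starting from zero labels, strand 1 meets strand 2 with \<open>p\<close>-label \<open>1\<close> if strand 2 has crossed
  strand 3 before, and with \<open>p\<close>-label \<open>0\<close> otherwise. The \<open>q\<close>-label of strand 1 remembers the
  difference.\<close>

lemma VL_pure_not_commute:
  assumes "n \<ge> 3"
  shows "(vl_ell n 1 \<otimes>\<^bsub>VL n\<^esub> vl_rho n 1) \<otimes>\<^bsub>VL n\<^esub> (vl_ell n 2 \<otimes>\<^bsub>VL n\<^esub> vl_rho n 2) \<noteq>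
    (vl_ell n 2 \<otimes>\<^bsub>VL n\<^esub> vl_rho n 2) \<otimes>\<^bsub>VL n\<^esub> (vl_ell n 1 \<otimes>\<^bsub>VL n\<^esub> vl_rho n 1)" (is "?y \<noteq> ?z")
proof
  assume eq: "?y = ?z"
  obtain h where h: "h \<in> hom (VL n) (BijGroup UNIV)"
    "\<And>i. i \<in> {1..n - 1} \<Longrightarrow> h (vl_ell n i) = act_at heis_braiding i"
    "\<And>i. i \<in> {1..n - 1} \<Longrightarrow> h (vl_rho n i) = act_at prod.swap i"
    using VL_strand_action[of n] by blast
  interpret group_hom "VL n" "BijGroup UNIV" h
    using h(1) group_VL group_BijGroup by (simp add: group_hom_def group_hom_axioms_def)
  define y where "y i = vl_ell n i \<otimes>\<^bsub>VL n\<^esub> vl_rho n i" for i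
  define crossing where "crossing i = act_at heis_braiding i \<circ> act_at prod.swap i" for i
  have y: "y i \<in> carrier (VL n)" "h (y i) = crossing i" "bij (crossing i)"
    if i: "i \<in> {1..n - 1}" for i
  proof -
    have "bij (act_at heis_braiding i)" "bij (act_at prod.swap i :: _ \<Rightarrow> nat \<Rightarrow> int \<times> int)"
      using hom_closed[OF vl_ell_carrier[OF i]] hom_closed[OF vl_rho_carrier[OF i]] h i
      by (simp_all add: BijGroup_UNIV_carrier)
    then show "y i \<in> carrier (VL n)" "h (y i) = crossing i" "bij (crossing i)"
      using i by (simp_all add: y_def crossing_def vl_ell_carrier vl_rho_carrier h
          BijGroup_UNIV_mult bij_comp)
  qed
  have idx: "1 \<in> {1..n - 1}" "2 \<in> {1..n - 1}" using assms by auto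
  have "crossing 1 \<circ> crossing 2 = h (y 1 \<otimes>\<^bsub>VL n\<^esub> y 2)"
    using idx[THEN y(1)] by (simp only: hom_mult idx[THEN y(2)] idx[THEN y(3)] BijGroup_UNIV_mult)
  also have "\<dots> = h (y 2 \<otimes>\<^bsub>VL n\<^esub> y 1)" using eq by (simp only: y_def)
  also have "\<dots> = crossing 2 \<circ> crossing 1"
    using idx[THEN y(1)] by (simp only: hom_mult idx[THEN y(2)] idx[THEN y(3)] BijGroup_UNIV_mult)
  finally have "(crossing 1 \<circ> crossing 2) (\<lambda>_. (0, 0)) 1 = (crossing 2 \<circ> crossing 1) (\<lambda>_. (0, 0)) 1" by simp
  then show False by (simp add: crossing_def act_at_def heis_braiding_def)
qed

lemma VL_unfaithful:
  assumes n: "n \<ge> 3" and \<omega>: "\<omega> \<in> hom (VL n) (GL n)"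
    and ell: "\<And>i. i \<in> {1..n - 1} \<Longrightarrow> \<omega> (vl_ell n i) = block_gen n b i"
    and rho: "\<And>i. i \<in> {1..n - 1} \<Longrightarrow> \<omega> (vl_rho n i) = block_gen n x i"
  shows "\<not> inj_on \<omega> (carrier (VL n))"
proof
  assume inj: "inj_on \<omega> (carrier (VL n))"
  interpret group_hom "VL n" "GL n" \<omega>
    using \<omega> group_VL group_GL by (simp add: group_hom_def group_hom_axioms_def)
  define y where "y i = vl_ell n i \<otimes>\<^bsub>VL n\<^esub> vl_rho n i" for i
  have y: "y i \<in> carrier (VL n)" "\<omega> (y i) = mono_mat n (\<lambda>r. r) (\<lambda>r. tc b i r * tc x i (tp i r))"
    if "i \<in> {1..n - 1}" for i
    using that n by (auto simp: y_def vl_ell_carrier vl_rho_carrier ell rho GL_simps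
        intro!: block_gen_mult_diagonal)
  have idx: "1 \<in> {1..n - 1}" "2 \<in> {1..n - 1}" using n by auto
  have "\<omega> (y 1 \<otimes>\<^bsub>VL n\<^esub> y 2) = \<omega> (y 2 \<otimes>\<^bsub>VL n\<^esub> y 1)"
    using idx[THEN y(1)] by (simp only: hom_mult idx[THEN y(2)] GL_simps diagonal_mult_commute)
  then have "y 1 \<otimes>\<^bsub>VL n\<^esub> y 2 = y 2 \<otimes>\<^bsub>VL n\<^esub> y 1"
    using inj idx[THEN y(1)] by (meson G.m_closed inj_onD)
  with VL_pure_not_commute[OF n] show False by (simp add: y_def)
qed

section \<open>Unfaithfulness of the representation\<close>

theorem theorem25:
  fixes b x :: complex and n :: nat and \<omega> :: "vl_gen word set \<Rightarrow> complex mat"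
  assumes "b \<noteq> 0" and "x \<noteq> 0" and "n \<ge> 2"
    and "\<omega> \<in> hom (VL n) (GL n)"
    and "\<And>i. i \<in> {1..n - 1} \<Longrightarrow> \<omega> (vl_ell n i) = block_gen n b i"
    and "\<And>i. i \<in> {1..n - 1} \<Longrightarrow> \<omega> (vl_rho n i) = block_gen n x i"
  shows "(n = 2 \<longrightarrow> (\<not> inj_on \<omega> (carrier (VL n)) \<longleftrightarrow> (\<exists>m::nat. m > 0 \<and> (b / x) ^ m = 1)))
    \<and> (n \<ge> 3 \<longrightarrow> \<not> inj_on \<omega> (carrier (VL n)))"
proof (intro conjI impI)
  assume "n = 2"
  with assms show "\<not> inj_on \<omega> (carrier (VL n)) \<longleftrightarrow> (\<exists>m::nat. m > 0 \<and> (b / x) ^ m = 1)"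
    using VL2_unfaithful_iff[of b x \<omega>] by simp
next
  assume "n \<ge> 3"
  with assms show "\<not> inj_on \<omega> (carrier (VL n))"
    by (intro VL_unfaithful)
qed

end
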